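(* Let $f:\mathbb{R}^n\to\mathbb{R}^n$ be Lipschitz continuous, let $\mathcal{C}\subset\mathbb{R}^n$ be a compact set, and let $\mathcal{U}\subset\mathbb{R}^n$ be an invariant set of $\frac{d}{dt}x=f(x)$ (i.e., $\varphi_f(t,x_0)\in\mathcal{U}$ for all $t\in\mathbb{R}_{>0}$ and all $x_0\in\mathcal{U}$) such that $\mathcal{C}\cap\mathcal{U}=\emptyset$. Let $\mathcal{V}:\mathbb{R}^n\to\mathbb{R}_{\geq 0}$ be continuously differentiable and suppose there are comparison functions $\chi_1,\chi_2\in\mathscr{K}_\infty$ and $\chi_3\in\mathscr{K}$ such that $$\chi_1(\|x\|_{\mathcal{C}})\le \mathcal{V}(x)\le\chi_2(\|x\|_{\mathcal{C}}),\qquad \frac{d}{dt}\mathcal{V}(x):=\frac{\partial\mathcal{V}}{\partial x}f(x)\le-\chi_3(\|x\|_{\mathcal{C}\cup\mathcal{U}})$$ hold for all $x\in\mathbb{R}^n$. Let $$\mathcal{Z}_{\mathcal{U}}:=\{x_0\in\mathbb{R}^n \mid \lim_{t\to\infty}\|\varphi_f(t,x_0)\|_{\mathcal{U}}=0\}$$ denote the region of attraction of $\mathcal{U}$. If $\mathcal{Z}_{\mathcal{U}}$ has zero Lebesgue measure, then the dynamics $\frac{d}{dt}x=f(x)$ are almost globally asymptotically stable with respect to $\mathcal{C}$.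
   Context: Notation: $\varphi_f(t,x_0)$ is the solution at time $t\ge 0$ of $\frac{d}{dt}x=f(x)$ with $x(0)=x_0$. For a set $\mathcal{D}\subset\mathbb{R}^n$, $\|x\|_{\mathcal{D}}:=\inf_{z\in\mathcal{D}}\|z-x\|$ is the Euclidean point-to-set distance (a minimum for closed $\mathcal{D}$). Comparison functions: $\chi:\mathbb{R}_{\ge0}\to\mathbb{R}_{\ge0}$ is of class $\mathscr{K}$ if it is continuous, strictly increasing and $\chi(0)=0$; it is of class $\mathscr{K}_\infty$ if it is of class $\mathscr{K}$ and $\chi(s)\to\infty$ as $s\to\infty$. Almost global asymptotic stability: $\frac{d}{dt}x=f(x)$ is almost globally asymptotically stable with respect to a compact set $\mathcal{C}$ if (i) it is almost globally attractive, i.e., $\lim_{t\to\infty}\|\varphi_f(t,x_0)\|_{\mathcal{C}}=0$ holds for all $x_0\notin\mathcal{Z}$, where $\mathcal{Z}$ is a set of zero Lebesgue measure; and (ii) it is Lyapunov stable with respect to $\mathcal{C}$, i.e., for every $\varepsilon>0$ there is $\delta>0$ such that $\|x_0\|_{\mathcal{C}}<\delta$ implies $\|\varphi_f(t,x_0)\|_{\mathcal{C}}<\varepsilon$ for all $t\ge0$. *)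

theory Defs
  imports "HOL-Analysis.Analysis"
begin

definition solves_ivp ::
    "(real ^ 'n \<Rightarrow> real ^ 'n) \<Rightarrow> real ^ 'n \<Rightarrow> (real \<Rightarrow> real ^ 'n) \<Rightarrow> bool" where
  "solves_ivp f x0 x \<longleftrightarrow>
     x 0 = x0 \<and> (\<forall>t\<ge>0. (x has_vector_derivative f (x t)) (at t within {0..}))"

(* Solutions are unrestricted at negative times, hence the description ranges over the
   value at time t rather than over the solution. It is proper for t \<ge> 0 whenever f is
   (globally) Lipschitz. *)
definition flow :: "(real ^ 'n \<Rightarrow> real ^ 'n) \<Rightarrow> real \<Rightarrow> real ^ 'n \<Rightarrow> real ^ 'n" where
  "flow f t x0 = (THE y. \<exists>x. solves_ivp f x0 x \<and> y = x t)"

(* Values at negative arguments are irrelevant; nonnegativity on {0..} follows. *)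
definition class_K :: "(real \<Rightarrow> real) \<Rightarrow> bool" where
  "class_K k \<longleftrightarrow> continuous_on {0..} k \<and> strict_mono_on {0..} k \<and> k 0 = 0"

definition class_K_inf :: "(real \<Rightarrow> real) \<Rightarrow> bool" where
  "class_K_inf k \<longleftrightarrow> class_K k \<and> filterlim k at_top at_top"

definition continuously_differentiable :: "(real ^ 'n \<Rightarrow> real) \<Rightarrow> bool" where
  "continuously_differentiable V \<longleftrightarrow>
     (\<exists>V' :: real ^ 'n \<Rightarrow> ((real ^ 'n) \<Rightarrow>\<^sub>L real).
        (\<forall>x. (V has_derivative blinfun_apply (V' x)) (at x)) \<and> continuous_on UNIV V')"

definition orbital_derivative ::
    "(real ^ 'n \<Rightarrow> real ^ 'n) \<Rightarrow> (real ^ 'n \<Rightarrow> real) \<Rightarrow> real ^ 'n \<Rightarrow> real" where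
  "orbital_derivative f V x = frechet_derivative V (at x) (f x)"

definition invariant_set :: "(real ^ 'n \<Rightarrow> real ^ 'n) \<Rightarrow> (real ^ 'n) set \<Rightarrow> bool" where
  "invariant_set f U \<longleftrightarrow> (\<forall>x0\<in>U. \<forall>t>0. flow f t x0 \<in> U)"

(* infdist x {} = 0 in the library, whereas an infimum over the empty set is infinite;
   the conjunct U \<noteq> {} makes the empty set attract nothing. *)
definition region_of_attraction ::
    "(real ^ 'n \<Rightarrow> real ^ 'n) \<Rightarrow> (real ^ 'n) set \<Rightarrow> (real ^ 'n) set" where
  "region_of_attraction f U =
     {x0. U \<noteq> {} \<and> ((\<lambda>t. infdist (flow f t x0) U) \<longlongrightarrow> 0) at_top}"

definition almost_globally_attractive ::
    "(real ^ 'n \<Rightarrow> real ^ 'n) \<Rightarrow> (real ^ 'n) set \<Rightarrow> bool" where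
  "almost_globally_attractive f C \<longleftrightarrow>
     (\<exists>Z \<in> null_sets lebesgue.
        \<forall>x0. x0 \<notin> Z \<longrightarrow> ((\<lambda>t. infdist (flow f t x0) C) \<longlongrightarrow> 0) at_top)"

definition lyapunov_stable ::
    "(real ^ 'n \<Rightarrow> real ^ 'n) \<Rightarrow> (real ^ 'n) set \<Rightarrow> bool" where
  "lyapunov_stable f C \<longleftrightarrow>
     (\<forall>\<epsilon>>0. \<exists>\<delta>>0. \<forall>x0. infdist x0 C < \<delta> \<longrightarrow>
        (\<forall>t\<ge>0. infdist (flow f t x0) C < \<epsilon>))"

definition almost_globally_asymptotically_stable ::
    "(real ^ 'n \<Rightarrow> real ^ 'n) \<Rightarrow> (real ^ 'n) set \<Rightarrow> bool" where
  "almost_globally_asymptotically_stable f C \<longleftrightarrow>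
     almost_globally_attractive f C \<and> lyapunov_stable f C"

end

theory Submission
  imports Defs
begin

text \<open>Along a trajectory \<open>V\<close> decreases, which gives stability and boundedness. Since the speed is
  bounded, a trajectory that is infinitely often far from \<open>C \<union> U\<close> would lose a fixed amount of
  \<open>V\<close> infinitely often; hence its distance to \<open>C \<union> U\<close> tends to zero. If the limit of \<open>V\<close> is
  zero, the trajectory converges to \<open>C\<close>; otherwise it stays away from \<open>C\<close>, so it converges to
  \<open>U\<close> and started in the null set. Global solutions come from Banach's fixed point theorem in an
  exponentially weighted supremum norm.\<close>

section \<open>Global solutions of Lipschitz initial value problems\<close>

lemma integral_has_vector_derivative_Ici:
  fixes g :: "real \<Rightarrow> 'a::banach"
  assumes "continuous_on {a..} g" "a \<le> t"
  shows "((\<lambda>u. integral {a..u} g) has_vector_derivative g t) (at t within {a..})"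
proof -
  have "((\<lambda>u. integral {a..u} g) has_vector_derivative g t) (at t within {a..t+1})"
    by (rule integral_has_vector_derivative)
       (use assms in \<open>auto intro: continuous_on_subset\<close>)
  moreover have "at t within {a..t+1} = at t within {a..}"
    by (rule at_within_nhd[of _ "{..<t+1}"]) auto
  ultimately show ?thesis by simp
qed

text \<open>Integrating \<open>exp (a * s)\<close> gains the factor \<open>1 / a\<close>. A large
  \<open>a\<close> thus makes the Picard operator contracting in the exponentially weighted
  norm.\<close>

lemma norm_integral_le_exp:
  fixes g :: "real \<Rightarrow> 'a::euclidean_space"
  assumes g: "continuous_on {0..} g" and a: "a > 0" and t: "t \<ge> 0"
    and le: "\<And>s. s \<ge> 0 \<Longrightarrow> norm (g s) \<le> K * exp (a * s)"
  shows "norm (integral {0..t} g) \<le> K * exp (a * t) / a"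
proof -
  have K: "K \<ge> 0"
    using order_trans[OF norm_ge_zero le[of 0]] by simp
  have int: "((\<lambda>s. K * exp (a * s)) has_integral K * exp (a * t) / a - K * exp (a * 0) / a) {0..t}"
    using a by (intro fundamental_theorem_of_calculus t)
      (auto simp: has_real_derivative_iff_has_vector_derivative[symmetric] intro!: derivative_eq_intros)
  have "norm (integral {0..t} g) \<le> integral {0..t} (\<lambda>s. K * exp (a * s))"
    using le int g by (intro integral_norm_bound_integral integrable_continuous_real)
      (auto intro: continuous_on_subset intro!: continuous_intros)
  also have "\<dots> = K * exp (a * t) / a - K * exp (a * 0) / a"
    by (rule integral_unique[OF int])
  also have "\<dots> \<le> K * exp (a * t) / a"
    using K a by simp
  finally show ?thesis .
qed

text \<open>The fixed point \<open>y\<close> stands for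
  \<open>exp (- (a * t)) *\<^sub>R x t\<close>, so the plain supremum norm of \<open>y\<close> is
  the weighted norm of \<open>x\<close>. One contraction then covers the whole half-line, and no
  local solutions have to be glued.\<close>

lemma solves_ivp_exists:
  fixes f :: "real ^ 'n \<Rightarrow> real ^ 'n"
  assumes "L-lipschitz_on UNIV f"
  shows "\<exists>x. solves_ivp f x0 x"
proof -
  \<comment> \<open>The maximum keeps \<open>a\<close> positive even when \<open>L = 0\<close>. The
    choice \<open>a = 2 * M\<close> makes the contraction factor \<open>M / a\<close> equal to
    \<open>1/2\<close>.\<close>
  define M where "M = max L 1"
  define a where "a = 2 * M"
  have M: "M \<ge> 1" and a: "a > 0" by (auto simp: M_def a_def)
  have lip: "M-lipschitz_on UNIV f"
    by (rule lipschitz_on_le[OF assms]) (simp add: M_def)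
  have lipD: "norm (f x - f y) \<le> M * norm (x - y)" for x y
    using lipschitz_onD[OF lip, of x y] by (simp add: dist_norm)
  have contf: "continuous_on S f" for S
    using lipschitz_on_continuous_on[OF lip] continuous_on_subset by blast
  define g where "g y s = f (exp (a * s) *\<^sub>R apply_bcontfun y s)" for y s
  have contg: "continuous_on S (g y)" for S y
    unfolding g_def
    by (intro continuous_on_compose2[OF contf[of UNIV]] continuous_intros) auto
  define I where "I y t = integral {0..t} (g y)" for y t
  have contI: "continuous_on {0..} (I y)" for y
    unfolding I_def
    by (rule continuous_on_vector_derivative, rule integral_has_vector_derivative_Ici[OF contg]) auto
  \<comment> \<open>Bounded continuous functions live on the whole real line, so
    \<open>max 0 t\<close> freezes the weighted Picard operator at its value at time 0 for negative
    times.\<close>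
  define G where "G y t = exp (- (a * max 0 t)) *\<^sub>R (x0 + I y (max 0 t))" for y and t :: real
  \<comment> \<open>A Lipschitz \<open>f\<close> grows at most linearly, and
    \<open>exp (a * s) \<ge> 1\<close> absorbs the constant \<open>norm (f 0)\<close>.\<close>
  have bound: "norm (g y s) \<le> (norm (f 0) + M * norm y) * exp (a * s)" if "s \<ge> 0" for y s
  proof -
    have "norm (g y s) \<le> norm (f 0) + M * norm (exp (a * s) *\<^sub>R apply_bcontfun y s)"
      unfolding g_def using lipD[of "exp (a * s) *\<^sub>R apply_bcontfun y s" 0]
        norm_triangle_sub[of "f (exp (a * s) *\<^sub>R apply_bcontfun y s)" "f 0"] by simp
    also have "\<dots> \<le> norm (f 0) * exp (a * s) + M * (exp (a * s) * norm y)"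
      using that a M norm_bounded[of y s] mult_left_mono[of 1 "exp (a * s)" "norm (f 0)"]
      by (intro add_mono mult_left_mono) auto
    finally show ?thesis by (simp add: algebra_simps)
  qed
  have G: "G y \<in> bcontfun" for y
  proof (rule bcontfun_normI)
    show "continuous_on UNIV (G y)"
      unfolding G_def
      by (intro continuous_intros continuous_on_compose2[OF contI]) auto
    fix t :: real
    define s where "s = max 0 t"
    have s: "s \<ge> 0" by (simp add: s_def)
    have "norm (G y t) = exp (- (a * s)) * norm (x0 + I y s)"
      by (simp add: G_def s_def)
    also have "\<dots> \<le> exp (- (a * s)) * (norm x0 + (norm (f 0) + M * norm y) * exp (a * s) / a)"
      unfolding I_def using norm_integral_le_exp[OF contg a s bound]
      by (intro mult_left_mono order_trans[OF norm_triangle_ineq] add_left_mono) auto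
    also have "\<dots> = exp (- (a * s)) * norm x0 + (norm (f 0) + M * norm y) / a"
      by (simp add: algebra_simps exp_minus)
    also have "\<dots> \<le> norm x0 + (norm (f 0) + M * norm y) / a"
      using a s by (simp add: mult_left_le_one_le)
    finally show "norm (G y t) \<le> norm x0 + (norm (f 0) + M * norm y) / a" .
  qed
  have "dist (Bcontfun (G y)) (Bcontfun (G z)) \<le> 1/2 * dist y z" for y z
  proof (rule dist_bound)
    fix t :: real
    define s where "s = max 0 t"
    have s: "s \<ge> 0" by (simp add: s_def)
    have gle: "norm (g y r - g z r) \<le> M * dist y z * exp (a * r)" if "r \<ge> 0" for r
    proof -
      have "norm (g y r - g z r)
          \<le> M * norm (exp (a * r) *\<^sub>R apply_bcontfun y r - exp (a * r) *\<^sub>R apply_bcontfun z r)"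
        unfolding g_def by (rule lipD)
      also have "\<dots> = M * (exp (a * r) * dist (apply_bcontfun y r) (apply_bcontfun z r))"
        by (simp add: dist_norm flip: scaleR_diff_right)
      also have "\<dots> \<le> M * (exp (a * r) * dist y z)"
        using M by (intro mult_left_mono dist_bounded) auto
      finally show ?thesis by (simp add: mult_ac)
    qed
    have "I y s - I z s = integral {0..s} (\<lambda>r. g y r - g z r)"
      unfolding I_def by (intro integral_diff[symmetric] integrable_continuous_real contg)
    then have "norm (I y s - I z s) \<le> M * dist y z * exp (a * s) / a"
      using norm_integral_le_exp[OF _ a s gle] contg
      by (simp add: continuous_on_diff)
    then have *: "exp (- (a * s)) * norm (I y s - I z s) \<le> exp (- (a * s)) * (M * dist y z * exp (a * s) / a)"
      by (intro mult_left_mono) auto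
    have "dist (G y t) (G z t) = exp (- (a * s)) * norm (I y s - I z s)"
      by (simp add: G_def s_def dist_norm flip: scaleR_diff_right)
    also note *
    also have "exp (- (a * s)) * (M * dist y z * exp (a * s) / a) = 1/2 * dist y z"
      using M by (simp add: exp_minus a_def field_simps)
    finally show "dist (apply_bcontfun (Bcontfun (G y)) t) (apply_bcontfun (Bcontfun (G z)) t)
        \<le> 1/2 * dist y z"
      by (simp add: Bcontfun_inverse G)
  qed
  then have "\<exists>!y. Bcontfun (G y) = y"
    by (intro banach_fix_type[where c = "1/2"]) auto
  then obtain y where "Bcontfun (G y) = y" by blast
  then have y: "apply_bcontfun y t = G y t" for t
    by (metis Bcontfun_inverse G)
  \<comment> \<open>This undoes the weight: for \<open>t \<ge> 0\<close> the fixed point equation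
    says \<open>exp (a * t) *\<^sub>R y t = x t\<close>, so the integrand of \<open>I y\<close> is
    \<open>f (x t)\<close>.\<close>
  define x where "x t = x0 + I y t" for t
  have xg: "g y t = f (x t)" if "t \<ge> 0" for t
    using that by (simp add: g_def y G_def x_def flip: exp_add)
  have "solves_ivp f x0 x"
    unfolding solves_ivp_def
  proof (intro conjI allI impI)
    show "x 0 = x0" by (simp add: x_def I_def)
    fix t :: real assume t: "0 \<le> t"
    have "(I y has_vector_derivative g y t) (at t within {0..})"
      unfolding I_def by (intro integral_has_vector_derivative_Ici contg t)
    then show "(x has_vector_derivative f (x t)) (at t within {0..})"
      unfolding x_def[abs_def] by (auto intro!: derivative_eq_intros simp: xg[OF t, unfolded x_def])
  qed
  then show ?thesis by blast
qed

section \<open>Monotonicity from the derivative, uniqueness of solutions, and the flow\<close>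

lemma antimono_on_interval_of_deriv_nonpos:
  fixes w w' :: "real \<Rightarrow> real"
  assumes "0 \<le> a" "a \<le> b"
    and d: "\<And>t. 0 \<le> t \<Longrightarrow> (w has_real_derivative w' t) (at t within {0..})"
    and neg: "\<And>t. a < t \<Longrightarrow> t < b \<Longrightarrow> w' t \<le> 0"
  shows "w b \<le> w a"
proof (cases "a = b")
  case False
  then have ab: "a < b" using assms by simp
  have "continuous_on {a..b} w"
    by (rule continuous_on_subset[OF DERIV_continuous_on[OF d]]) (use assms in auto)
  \<comment> \<open>Strictly between \<open>a\<close> and \<open>b\<close> the derivative within
    \<open>{0..}\<close> is two-sided; at the ends continuity suffices, so \<open>a = 0\<close> is
    allowed.\<close>
  moreover have "(w has_real_derivative w' t) (at t)" if "a < t" "t < b" for t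
  proof -
    have "at t within {0..} = at t"
      by (rule at_within_interior) (use that assms in \<open>auto simp: interior_real_atLeast\<close>)
    then show ?thesis using d[of t] that assms by simp
  qed
  ultimately show ?thesis
    by (intro DERIV_nonpos_imp_decreasing_open[OF assms(2)]) (use neg in blast)+
qed simp

text \<open>A Gronwall argument: the squared distance of two solutions grows at rate at most
  \<open>2 * L\<close>, so after weighting by \<open>exp (- (2 * L * s))\<close> it cannot increase,
  and it starts at zero.\<close>

lemma solves_ivp_unique:
  fixes f :: "real ^ 'n \<Rightarrow> real ^ 'n"
  assumes lip: "L-lipschitz_on UNIV f"
    and x: "solves_ivp f x0 x" and y: "solves_ivp f x0 y" and t: "t \<ge> 0"
  shows "x t = y t"
proof -
  define w where "w s = ((x s - y s) \<bullet> (x s - y s)) * exp (- (2 * L * s))" for s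
  define w' where "w' s = (2 * ((x s - y s) \<bullet> (f (x s) - f (y s)))
      - 2 * L * ((x s - y s) \<bullet> (x s - y s))) * exp (- (2 * L * s))" for s
  have "(w has_real_derivative w' s) (at s within {0..})" if "s \<ge> 0" for s
  proof -
    have "(x has_vector_derivative f (x s)) (at s within {0..})"
         "(y has_vector_derivative f (y s)) (at s within {0..})"
      using x y that by (auto simp: solves_ivp_def)
    note * = has_vector_derivative_diff[OF this]
    have "((\<lambda>s. (x s - y s) \<bullet> (x s - y s)) has_real_derivative
        2 * ((x s - y s) \<bullet> (f (x s) - f (y s)))) (at s within {0..})"
      unfolding has_field_derivative_def
      by (rule has_derivative_eq_rhs[OF has_derivative_inner[OF
            *[unfolded has_vector_derivative_def] *[unfolded has_vector_derivative_def]]])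
         (auto simp: fun_eq_iff algebra_simps inner_commute)
    moreover have "((\<lambda>s. exp (- (2 * L * s))) has_real_derivative
        - (2 * L) * exp (- (2 * L * s))) (at s within {0..})"
      by (auto intro!: derivative_eq_intros)
    ultimately show ?thesis
      unfolding w_def[abs_def] w'_def
      by (rule DERIV_cong[OF DERIV_mult]) (simp add: algebra_simps)
  qed
  moreover have "w' s \<le> 0" for s
  proof -
    have "(x s - y s) \<bullet> (f (x s) - f (y s)) \<le> norm (x s - y s) * norm (f (x s) - f (y s))"
      by (rule norm_cauchy_schwarz)
    also have "\<dots> \<le> norm (x s - y s) * (L * norm (x s - y s))"
      using lipschitz_onD[OF lip, of "x s" "y s"]
      by (intro mult_left_mono) (auto simp: dist_norm)
    finally have "(x s - y s) \<bullet> (f (x s) - f (y s)) \<le> L * ((x s - y s) \<bullet> (x s - y s))"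
      by (simp add: power2_norm_eq_inner[symmetric] power2_eq_square mult_ac)
    then show ?thesis
      unfolding w'_def by (intro mult_nonpos_nonneg) auto
  qed
  ultimately have "w t \<le> w 0"
    by (intro antimono_on_interval_of_deriv_nonpos[of 0 t w w']) (use t in auto)
  moreover have "w 0 = 0"
    using x y by (simp add: w_def solves_ivp_def)
  ultimately have "(x t - y t) \<bullet> (x t - y t) \<le> 0"
    by (simp add: w_def mult_le_0_iff not_le)
  then show ?thesis
    by (metis inner_ge_zero inner_eq_zero_iff order_antisym right_minus_eq)
qed

lemma flow_eq:
  fixes f :: "real ^ 'n \<Rightarrow> real ^ 'n"
  assumes "L-lipschitz_on UNIV f" "solves_ivp f x0 x" "t \<ge> 0"
  shows "flow f t x0 = x t"
  unfolding flow_def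
  by (rule the_equality) (use assms solves_ivp_unique in blast)+

text \<open>A derivative within \<open>{0..}\<close> sees only times \<open>t \<ge> 0\<close>, where
  the flow agrees with a genuine solution; its values at negative times do not matter.\<close>

lemma flow_solves_ivp:
  fixes f :: "real ^ 'n \<Rightarrow> real ^ 'n"
  assumes lip: "L-lipschitz_on UNIV f"
  shows "solves_ivp f x0 (\<lambda>t. flow f t x0)"
proof -
  obtain x where x: "solves_ivp f x0 x"
    using solves_ivp_exists[OF lip] by blast
  have eq: "flow f t x0 = x t" if "t \<ge> 0" for t
    using flow_eq[OF lip x that] .
  show ?thesis
    unfolding solves_ivp_def
  proof (intro conjI allI impI)
    show "flow f 0 x0 = x0"
      using x by (simp add: eq solves_ivp_def)
    fix t :: real assume t: "0 \<le> t"
    show "((\<lambda>t. flow f t x0) has_vector_derivative f (flow f t x0)) (at t within {0..})"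
      by (rule has_vector_derivative_transform[of _ _ _ x])
         (use t x in \<open>auto simp: eq solves_ivp_def\<close>)
  qed
qed

section \<open>Decrease of the Lyapunov function\<close>

lemma solves_ivp_orbital_derivative:
  fixes f :: "real ^ 'n \<Rightarrow> real ^ 'n"
  assumes "solves_ivp f x0 x" "continuously_differentiable V" "t \<ge> 0"
  shows "((\<lambda>t. V (x t)) has_real_derivative orbital_derivative f V (x t)) (at t within {0..})"
proof -
  obtain V' where V': "\<And>x. (V has_derivative blinfun_apply (V' x)) (at x)"
    using assms(2) by (auto simp: continuously_differentiable_def)
  have "(x has_derivative (\<lambda>h. h *\<^sub>R f (x t))) (at t within {0..})"
    using assms(1,3) by (auto simp: solves_ivp_def has_vector_derivative_def)
  from has_derivative_compose[OF this V'] show ?thesis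
    unfolding has_field_derivative_def orbital_derivative_def frechet_derivative_at[OF V', symmetric]
    by (rule has_derivative_eq_rhs) (simp add: fun_eq_iff blinfun.scaleR_right)
qed

section \<open>Comparison functions of class K\<close>

lemma class_K_less_iff:
  assumes "class_K k" "0 \<le> a" "0 \<le> b"
  shows "k a < k b \<longleftrightarrow> a < b"
  using assms strict_mono_on_less[of "{0..}" k a b] by (auto simp: class_K_def)

lemma class_K_pos:
  assumes "class_K k" "a > 0"
  shows "k a > 0"
  using class_K_less_iff[OF assms(1), of 0 a] assms by (simp add: class_K_def)

lemma class_K_nonneg:
  assumes "class_K k" "a \<ge> 0"
  shows "k a \<ge> 0"
  using class_K_pos[OF assms(1), of a] assms by (cases "a = 0") (auto simp: class_K_def)

text \<open>Continuity at 0 replaces an inverse of \<open>k\<close>. Applied to \<open>k2\<close>,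
  it yields the radius for stability and the distance kept from \<open>C\<close> while
  \<open>V\<close> stays above a positive level.\<close>

lemma class_K_small:
  assumes "class_K k" "e > 0"
  shows "\<exists>d>0. \<forall>s. 0 \<le> s \<longrightarrow> s < d \<longrightarrow> k s < e"
proof -
  have "continuous (at 0 within {0..}) k"
    using assms by (auto simp: class_K_def continuous_on_eq_continuous_within)
  then obtain d where "d > 0" "\<And>s. s \<in> {0..} \<Longrightarrow> dist s 0 < d \<Longrightarrow> dist (k s) (k 0) < e"
    using assms(2) unfolding continuous_within_eps_delta by blast
  then have "k s < e" if "0 \<le> s" "s < d" for s
    using assms(1) that by (fastforce simp: class_K_def dist_real_def abs_less_iff)
  then show ?thesis
    using \<open>d > 0\<close> by blast
qed

section \<open>Bounded speed and convergence of the distance to zero\<close>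

lemma solves_ivp_speed_bound:
  fixes f :: "real ^ 'n \<Rightarrow> real ^ 'n"
  assumes x: "solves_ivp f x0 x" and M: "\<And>t. t \<ge> 0 \<Longrightarrow> norm (f (x t)) \<le> M"
    and "0 \<le> s" "s \<le> t"
  shows "norm (x t - x s) \<le> M * (t - s)"
proof -
  have "norm (x t - x s) \<le> M * norm (t - s)"
  proof (rule differentiable_bound[where S = "{0..}" and f' = "\<lambda>t h. h *\<^sub>R f (x t)"])
    fix r :: real assume "r \<in> {0..}"
    then show "(x has_derivative (\<lambda>h. h *\<^sub>R f (x r))) (at r within {0..})"
      using x by (auto simp: solves_ivp_def has_vector_derivative_def)
    show "onorm (\<lambda>h. h *\<^sub>R f (x r)) \<le> M"
      using M[of r] \<open>r \<in> {0..}\<close> by (simp add: onorm_scaleR_left onorm_id)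
  qed (use assms in auto)
  then show ?thesis using assms by simp
qed

text \<open>An argument in the style of Barbalat. By \<open>lower\<close> and \<open>upper\<close>,
  \<open>w\<close> tends to \<open>v\<close>. Once \<open>w\<close> is close enough to
  \<open>v\<close>, a single excursion to distance \<open>e\<close> from \<open>S\<close> would
  already push \<open>w\<close> below \<open>v\<close>.\<close>

lemma infdist_tendsto_zero_of_decrease:
  fixes f :: "real ^ 'n \<Rightarrow> real ^ 'n"
  assumes x: "solves_ivp f x0 x"
    and speed: "\<And>t. t \<ge> 0 \<Longrightarrow> norm (f (x t)) \<le> M"
    and w: "\<And>t. 0 \<le> t \<Longrightarrow> (w has_real_derivative w' t) (at t within {0..})"
    and k: "class_K k" and w': "\<And>t. t \<ge> 0 \<Longrightarrow> w' t \<le> - k (infdist (x t) S)"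
    and lower: "\<And>t. t \<ge> 0 \<Longrightarrow> v \<le> w t"
    and upper: "\<And>e. e > 0 \<Longrightarrow> \<forall>\<^sub>F t in at_top. w t < v + e"
  shows "((\<lambda>t. infdist (x t) S) \<longlongrightarrow> 0) at_top"
proof (rule tendstoI)
  fix e :: real assume e: "e > 0"
  define N where "N = max M 1"
  have N: "N \<ge> 1" "\<And>t. t \<ge> 0 \<Longrightarrow> norm (f (x t)) \<le> N"
    using speed by (auto simp: N_def le_max_iff_disj)
  \<comment> \<open>At speed at most \<open>N\<close>, covering the distance \<open>e/2\<close>
    takes at least time \<open>h\<close>.\<close>
  define h where "h = e / (2 * N)"
  have h: "h > 0" using e N(1) by (simp add: h_def)
  have ke: "k (e/2) > 0"
    using class_K_pos[OF k] e by simp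
  have "\<forall>\<^sub>F t in at_top. w t < v + k (e/2) * h"
    by (rule upper) (use ke h in simp)
  then show "\<forall>\<^sub>F t in at_top. dist (infdist (x t) S) 0 < e"
    using eventually_ge_at_top[of 0]
  proof eventually_elim
    case (elim t)
    show ?case
    proof (rule ccontr)
      assume "\<not> ?thesis"
      then have far: "infdist (x t) S \<ge> e" by (simp add: infdist_nonneg)
      have still_far: "infdist (x s) S \<ge> e/2" if "t \<le> s" "s \<le> t + h" for s
      proof -
        have "dist (x t) (x s) \<le> N * (s - t)"
          using solves_ivp_speed_bound[OF x N(2), of t s] elim that
          by (simp add: dist_norm norm_minus_commute)
        also have "\<dots> \<le> N * h"
          using N(1) that by (intro mult_left_mono) auto
        also have "\<dots> = e/2" using N(1) by (simp add: h_def)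
        finally show ?thesis
          using far infdist_triangle[of "x t" S "x s"] by linarith
      qed
      \<comment> \<open>The linear term turns decrease at rate at least \<open>k (e/2)\<close> into
        plain monotonicity. The loss over time \<open>h\<close> is \<open>k (e/2) * h\<close>,
        exactly the margin that \<open>w t\<close> has above \<open>v\<close>.\<close>
      have "w (t + h) + k (e/2) * (t + h) \<le> w t + k (e/2) * t"
      proof (rule antimono_on_interval_of_deriv_nonpos[of t "t + h"
            "\<lambda>s. w s + k (e/2) * s" "\<lambda>s. w' s + k (e/2)"])
        fix s assume s: "t < s" "s < t + h"
        have "k (e/2) \<le> k (infdist (x s) S)"
          using class_K_less_iff[OF k, of "infdist (x s) S" "e/2"] still_far[of s] s e
          by (simp add: infdist_nonneg not_less[symmetric])
        then show "w' s + k (e/2) \<le> 0" using w'[of s] s elim by simp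
      qed (use elim h in \<open>auto intro!: derivative_eq_intros w\<close>)
      then show False
        using lower[of "t + h"] elim h by (simp add: algebra_simps)
    qed
  qed
qed

section \<open>Almost global asymptotic stability\<close>

theorem theorem1:
  fixes f :: "real ^ 'n \<Rightarrow> real ^ 'n"
    and C U :: "(real ^ 'n) set"
    and V :: "real ^ 'n \<Rightarrow> real"
    and k1 k2 k3 :: "real \<Rightarrow> real"
  assumes "\<exists>L. L-lipschitz_on UNIV f"
    and "compact C"
    and "invariant_set f U"
    and "C \<inter> U = {}"
    and "\<And>x. 0 \<le> V x"
    and "continuously_differentiable V"
    and "class_K_inf k1" and "class_K_inf k2" and "class_K k3"
    and "\<And>x. k1 (infdist x C) \<le> V x"
    and "\<And>x. V x \<le> k2 (infdist x C)"
    and "\<And>x. orbital_derivative f V x \<le> - k3 (infdist x (C \<union> U))"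
    and "region_of_attraction f U \<in> null_sets lebesgue"
  shows "almost_globally_asymptotically_stable f C"
proof (cases "C = {}")
  \<comment> \<open>Distances to the empty set are 0 by convention, so both properties hold
    trivially.\<close>
  case True
  then show ?thesis
    by (auto simp: almost_globally_asymptotically_stable_def almost_globally_attractive_def
        lyapunov_stable_def infdist_def intro: exI[of _ 1] bexI[of _ "{}"])
next
  case C: False
  obtain L where L: "L-lipschitz_on UNIV f" using assms(1) by blast
  have K1: "class_K k1" and K2: "class_K k2"
    using assms(7,8) by (auto simp: class_K_inf_def)
  note ivp = flow_solves_ivp[OF L]
  note deriv = solves_ivp_orbital_derivative[OF ivp assms(6)]
  have nonpos: "orbital_derivative f V x \<le> 0" for x
    using class_K_nonneg[OF assms(9) infdist_nonneg, of x "C \<union> U"] assms(12)[of x] by linarith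
  have anti: "V (flow f t x0) \<le> V (flow f s x0)" if "0 \<le> s" "s \<le> t" for s t x0
    by (rule antimono_on_interval_of_deriv_nonpos[OF that deriv nonpos])
  have flow0: "flow f 0 x0 = x0" for x0
    using ivp by (simp add: solves_ivp_def)
  \<comment> \<open>The lower bound \<open>k1\<close> read backwards: small \<open>V\<close> forces
    closeness to \<open>C\<close>. It serves stability, boundedness and the case
    \<open>v \<le> 0\<close>.\<close>
  have close: "infdist x C < e" if "V x < k1 e" "e > 0" for x e
    using class_K_less_iff[OF K1, of "infdist x C" e] assms(10)[of x] that
    by (simp add: infdist_nonneg)

  have "lyapunov_stable f C"
    unfolding lyapunov_stable_def
  proof (intro allI impI)
    fix e :: real assume e: "e > 0"
    have "k1 e > 0"
      using class_K_pos[OF K1 e] .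
    then obtain d where d: "d > 0" "\<And>s. 0 \<le> s \<Longrightarrow> s < d \<Longrightarrow> k2 s < k1 e"
      using class_K_small[OF K2] by blast
    have "infdist (flow f t x0) C < e" if "infdist x0 C < d" "t \<ge> 0" for x0 t
    proof (rule close[OF _ e])
      have "V (flow f t x0) \<le> V x0"
        using anti[of 0 t x0] that flow0 by simp
      also have "\<dots> \<le> k2 (infdist x0 C)" by (rule assms)
      also have "\<dots> < k1 e" using d that by (simp add: infdist_nonneg)
      finally show "V (flow f t x0) < k1 e" .
    qed
    then show "\<exists>d>0. \<forall>x0. infdist x0 C < d \<longrightarrow> (\<forall>t\<ge>0. infdist (flow f t x0) C < e)"
      using d by blast
  qed

  moreover have "((\<lambda>t. infdist (flow f t x0) C) \<longlongrightarrow> 0) at_top"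
    if x0: "x0 \<notin> region_of_attraction f U" for x0
  proof -
    define x where "x t = flow f t x0" for t
    \<comment> \<open>Since \<open>V\<close> is nonincreasing along the trajectory, this infimum is
      also its limit.\<close>
    define v where "v = (INF t\<in>{0..}. V (x t))"
    have bdd: "bdd_below ((\<lambda>t. V (x t)) ` {0..})"
      using assms(5) by (intro bdd_belowI[of _ 0]) auto
    have lower: "v \<le> V (x t)" if "t \<ge> 0" for t
      unfolding v_def using that by (intro cINF_lower bdd) auto
    have upper: "\<forall>\<^sub>F t in at_top. V (x t) < v + e" if "e > 0" for e
    proof -
      have "(INF t\<in>{0..}. V (x t)) < v + e" using that by (simp add: v_def)
      then obtain s where s: "s \<ge> 0" "V (x s) < v + e"
        using cINF_less_iff[OF _ bdd] by auto
      show ?thesis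
        using eventually_ge_at_top[of s]
        by eventually_elim (use anti[of s _ x0] s in \<open>fastforce simp: x_def\<close>)
    qed
    \<comment> \<open>As \<open>k1\<close> is unbounded, some \<open>r\<close> has
      \<open>k1 r > V x0\<close>. The trajectory then stays within \<open>r\<close> of the compact
      set \<open>C\<close>, and \<open>f\<close> is bounded there by its linear growth.\<close>
    have "\<exists>M. \<forall>t\<ge>0. norm (f (x t)) \<le> M"
    proof -
      have "\<forall>\<^sub>F r in at_top. k1 r > V x0"
        using assms(7) by (simp add: class_K_inf_def filterlim_at_top_dense)
      then have "\<forall>\<^sub>F r in at_top. k1 r > V x0 \<and> r > 0"
        using eventually_gt_at_top[of 0] by eventually_elim simp
      then obtain r where r: "k1 r > V x0" "r > 0"
        using eventually_happens'[OF trivial_limit_at_top_linorder] by blast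
      obtain b where b: "\<And>c. c \<in> C \<Longrightarrow> norm c \<le> b"
        using compact_imp_bounded[OF assms(2)] by (auto simp: bounded_iff)
      have "norm (f (x t)) \<le> norm (f 0) + L * (r + b)" if "t \<ge> 0" for t
      proof -
        have "infdist (x t) C < r"
          using anti[of 0 t x0] that r by (intro close) (auto simp: x_def flow0)
        moreover obtain c where c: "c \<in> C" "infdist (x t) C = dist (x t) c"
          using infdist_attains_inf[OF compact_imp_closed[OF assms(2)] C] by blast
        ultimately have "norm (x t) \<le> r + b"
          using b[of c] norm_triangle_sub[of "x t" c] by (simp add: dist_norm)
        moreover have "norm (f (x t) - f 0) \<le> L * norm (x t)"
          using lipschitz_onD[OF L, of "x t" 0] by (simp add: dist_norm)
        moreover have "L \<ge> 0" using lipschitz_on_nonneg[OF L] .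
        ultimately show ?thesis
          using norm_triangle_sub[of "f (x t)" "f 0"] mult_left_mono[of "norm (x t)" "r + b" L]
          by linarith
      qed
      then show ?thesis by blast
    qed
    then obtain M where M: "\<And>t. t \<ge> 0 \<Longrightarrow> norm (f (x t)) \<le> M" by blast
    have lim: "((\<lambda>t. infdist (x t) (C \<union> U)) \<longlongrightarrow> 0) at_top"
    proof (rule infdist_tendsto_zero_of_decrease[where f = f and w = "\<lambda>t. V (x t)"])
      show "solves_ivp f x0 x" using ivp by (simp add: x_def[abs_def])
      show "((\<lambda>t. V (x t)) has_real_derivative orbital_derivative f V (x t)) (at t within {0..})"
        if "0 \<le> t" for t
        using deriv[OF that] by (simp add: x_def)
    qed (use M assms(9,12) lower upper in auto)
    \<comment> \<open>The case \<open>U = {}\<close> is split off because \<open>infdist\<close> to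
      the empty set is 0; there \<open>lim\<close> already speaks of \<open>C\<close> alone.\<close>
    show ?thesis
    proof (cases "v > 0 \<and> U \<noteq> {}")
      case True
      then obtain d where d: "d > 0" "\<And>s. 0 \<le> s \<Longrightarrow> s < d \<Longrightarrow> k2 s < v"
        using class_K_small[OF K2] by blast
      \<comment> \<open>A distance below \<open>d\<close> would give
        \<open>V (x t) \<le> k2 (infdist (x t) C) < v\<close>, against \<open>lower\<close>.\<close>
      have far: "infdist (x t) C \<ge> d" if "t \<ge> 0" for t
        using d(2)[of "infdist (x t) C"] lower[OF that] assms(11)[of "x t"]
        by (force simp: infdist_nonneg)
      have "\<forall>\<^sub>F t in at_top. infdist (x t) (C \<union> U) < d"
        by (rule order_tendstoD(2)[OF lim d(1)])
      \<comment> \<open>The distance to the union is the smaller of the two distances; once it is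
        below \<open>d\<close>, it cannot be the one to \<open>C\<close>.\<close>
      then have "\<forall>\<^sub>F t in at_top. infdist (x t) (C \<union> U) = infdist (x t) U"
        using eventually_ge_at_top[of 0]
      proof eventually_elim
        case (elim t)
        then show ?case
          using far[of t] True C by (auto simp: infdist_Un_min min_def split: if_splits)
      qed
      then have "((\<lambda>t. infdist (x t) U) \<longlongrightarrow> 0) at_top"
        using lim by (simp add: tendsto_cong)
      \<comment> \<open>The trajectory would be attracted to \<open>U\<close>, contradicting the
        choice of \<open>x0\<close>.\<close>
      then show ?thesis
        using x0 True by (simp add: region_of_attraction_def x_def)
    next
      case False
      then consider "U = {}" | "v \<le> 0" by linarith
      then show ?thesis
      proof cases
        case 1
        then show ?thesis using lim by (simp add: x_def)
      next
        case 2
        show ?thesis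
        proof (rule tendstoI)
          fix e :: real assume e: "e > 0"
          have "k1 e > 0"
            using class_K_pos[OF K1 e] .
          from upper[OF this] show "\<forall>\<^sub>F t in at_top. dist (infdist (flow f t x0) C) 0 < e"
          proof eventually_elim
            case (elim t)
            then show ?case
              using 2 close[of "x t" e] e by (simp add: infdist_nonneg x_def)
          qed
        qed
      qed
    qed
  qed
  \<comment> \<open>The exceptional null set is the region of attraction of \<open>U\<close>
    itself.\<close>
  ultimately show ?thesis
    using assms(13)
    by (auto simp: almost_globally_asymptotically_stable_def almost_globally_attractive_def)
qed

end
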